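(* Let $\mathbb{F}$ be an algebraically closed field of characteristic zero. Every irreducible affine plane curve $\mathcal{C}\subset\mathbb{F}^2$ of degree less than or equal to $5$ is soluble by radicals.
   Context: Let $t$ be transcendental over $\mathbb{F}$, $\mathbb{K}=\mathbb{F}(t)$, and fix an algebraic closure $\overline{\mathbb{K}}$ of $\mathbb{K}$. Root towers. For $g\in\mathbb{K}[x]$, a root tower for $g$ over $\mathbb{K}$ is a finite tower of fields $\mathbb{K}=\mathbb{K}_0\subset\mathbb{K}_1\subset\cdots\subset\mathbb{K}_s=\mathbb{E}$ (inside $\overline{\mathbb{K}}$) such that each $\mathbb{K}_i$ is the splitting field over $\mathbb{K}_{i-1}$ of a polynomial $x^{\ell_i}-a_i\in\mathbb{K}_{i-1}[x]$ with $\ell_i>0$, $a_i\neq0$, and the splitting field of $g$ over $\mathbb{K}$ is contained in $\mathbb{K}_s$; $g$ is soluble (by radicals) over $\mathbb{K}$ if such a tower exists. Affine square parametrization: a tuple $(R_1,\ldots,R_n)\in\mathbb{E}^n\setminus\mathbb{F}^n$, where $\mathbb{E}$ is the last field of a root tower over $\mathbb{K}$ of some $g\in\mathbb{K}[x]$ soluble over $\mathbb{K}$. Evaluation. For each $t_0\in\mathbb{F}$ fix a place of $\overline{\mathbb{K}}$ over $\mathbb{F}$ extending $t\mapsto t_0$, i.e. a valuation ring $O_{t_0}\supset\mathbb{F}$ of $\overline{\mathbb{K}}$ with $t-t_0$ in its maximal ideal; its residue field is $\mathbb{F}$ (this is a compatible choice of the values at $t_0$ of all radicals). $S(t_0)$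 is well defined if $S\in O_{t_0}$, and then it is the residue of $S$ in $\mathbb{F}$; tuples are evaluated coordinatewise. Soluble by radicals. An irreducible affine curve $\mathcal{E}\subset\mathbb{F}^n$ is soluble by radicals (parametrizable by radicals) if there is a finite set of square parametrizations $\{\mathcal{P}_i(t)\}_{i=1,\ldots,r}$ such that (1) for all $i$ and all $t_0\in\mathbb{F}$ such that $\mathcal{P}_i(t_0)$ is defined, $\mathcal{P}_i(t_0)\in\mathcal{E}$; (2) for all but finitely many $P\in\mathcal{E}$ there exist $t_0\in\mathbb{F}$ and $i$ with $P=\mathcal{P}_i(t_0)$. *)

theory Defs
  imports
    "HOL-Algebra.Algebraic_Closure_Type"
    "HOL-Algebra.Generated_Fields"
    "HOL-Computational_Algebra.Fraction_Field"
    "HOL-Analysis.Finite_Cartesian_Product"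
begin

section \<open>The rational function field and its algebraic closure\<close>

type_synonym 'a ratfun = "'a poly fract"

type_synonym 'a ratfun_closure = "'a ratfun alg_closure"

definition ratfun_subfield :: "'a::field ratfun_closure set" where
  "ratfun_subfield = range to_ac"

definition const_emb :: "'a::field \<Rightarrow> 'a ratfun_closure" where
  "const_emb c = to_ac (Fract [:c:] 1)"

definition param_var :: "'a::field ratfun_closure" where
  "param_var = to_ac (Fract [:0, 1:] 1)"


section \<open>Root towers\<close>

text \<open>
  Subfields of an ambient field \<open>'b\<close> are represented by their carrier sets. The splitting field
  is formed inside \<open>'b\<close>, which is an algebraically closed field in all uses below; \<open>p\<close> is a
  polynomial over \<open>'b\<close> whose coefficients lie in \<open>K\<close>.
\<close>

definition splitting_field_over :: "'b::field set \<Rightarrow> 'b poly \<Rightarrow> 'b set" where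
  "splitting_field_over K p = generate_field ring_of_type_algebra (K \<union> {x. poly p x = 0})"

definition root_tower :: "'a::field ratfun poly \<Rightarrow> 'a ratfun_closure set list \<Rightarrow> bool" where
  "root_tower g Ks \<longleftrightarrow>
     Ks \<noteq> [] \<and> Ks ! 0 = ratfun_subfield \<and>
     (\<forall>i. Suc i < length Ks \<longrightarrow>
        (\<exists>l a. l > 0 \<and> a \<in> Ks ! i \<and> a \<noteq> 0 \<and>
           Ks ! Suc i = splitting_field_over (Ks ! i) (Polynomial.monom 1 l - [:a:]))) \<and>
     splitting_field_over ratfun_subfield (map_poly to_ac g) \<subseteq> last Ks"

definition soluble_poly :: "'a::field ratfun poly \<Rightarrow> bool" where
  "soluble_poly g \<longleftrightarrow> (\<exists>Ks. root_tower g Ks)"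

definition square_parametrization :: "('a::field ratfun_closure) ^ 'n \<Rightarrow> bool" where
  "square_parametrization R \<longleftrightarrow>
     (\<exists>g Ks. soluble_poly g \<and> root_tower g Ks \<and> (\<forall>j. R $ j \<in> last Ks)) \<and>
     \<not> (\<forall>j. R $ j \<in> range const_emb)"


section \<open>Evaluation at places\<close>

definition valuation_subring :: "'b::field set \<Rightarrow> bool" where
  "valuation_subring V \<longleftrightarrow>
     subring V ring_of_type_algebra \<and> (\<forall>x. x \<noteq> 0 \<longrightarrow> x \<in> V \<or> inverse x \<in> V)"

text \<open>The maximal ideal of a valuation ring consists of its non-units.\<close>

definition valuation_ideal :: "'b::field set \<Rightarrow> 'b set" where
  "valuation_ideal V = {x \<in> V. x = 0 \<or> inverse x \<notin> V}"

definition place_over :: "'a::field \<Rightarrow> 'a ratfun_closure set \<Rightarrow> bool" where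
  "place_over t0 V \<longleftrightarrow>
     valuation_subring V \<and> range const_emb \<subseteq> V \<and> param_var - const_emb t0 \<in> valuation_ideal V"

text \<open>
  For a place over \<open>t0\<close> and algebraically closed \<open>'a\<close>, the composite of \<open>const_emb\<close> with
  reduction modulo the maximal ideal is a bijection onto the residue field, so the description
  below then denotes the residue of every \<open>S\<close> in \<open>V\<close>. It is used only for such \<open>S\<close>.
\<close>

definition residue_at :: "'a::field ratfun_closure set \<Rightarrow> 'a ratfun_closure \<Rightarrow> 'a" where
  "residue_at V S = (THE c. S - const_emb c \<in> valuation_ideal V)"

definition tuple_defined_at ::
    "'a::field ratfun_closure set \<Rightarrow> ('a ratfun_closure) ^ 'n \<Rightarrow> bool" where
  "tuple_defined_at V R \<longleftrightarrow> (\<forall>j. R $ j \<in> V)"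

definition tuple_value_at ::
    "'a::field ratfun_closure set \<Rightarrow> ('a ratfun_closure) ^ 'n \<Rightarrow> 'a ^ 'n" where
  "tuple_value_at V R = (\<chi> j. residue_at V (R $ j))"


section \<open>Curves soluble by radicals\<close>

text \<open>\<open>V t0\<close> is the chosen place over \<open>t0\<close>; the same choice serves all parametrizations.\<close>

definition soluble_by_radicals ::
    "('a::field \<Rightarrow> 'a ratfun_closure set) \<Rightarrow> ('a ^ 'n) set \<Rightarrow> bool" where
  "soluble_by_radicals V E \<longleftrightarrow>
     (\<exists>Ps. finite Ps \<and> (\<forall>R\<in>Ps. square_parametrization R) \<and>
        (\<forall>R\<in>Ps. \<forall>t0. tuple_defined_at (V t0) R \<longrightarrow> tuple_value_at (V t0) R \<in> E) \<and>
        finite {P \<in> E. \<not> (\<exists>t0. \<exists>R\<in>Ps. tuple_defined_at (V t0) R \<and> P = tuple_value_at (V t0) R)})"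


section \<open>Plane curves\<close>

text \<open>
  A polynomial in \<open>x\<close> and \<open>y\<close> is represented as a polynomial in \<open>y\<close> with coefficients in
  \<open>'a[x]\<close>.
\<close>

definition total_deg :: "'a::zero poly poly \<Rightarrow> nat" where
  "total_deg f =
     Max (insert 0 {i + j | i j. Polynomial.coeff (Polynomial.coeff f j) i \<noteq> 0})"

definition plane_zeros :: "'a::comm_ring_1 poly poly \<Rightarrow> ('a ^ 2) set" where
  "plane_zeros f = {P. poly (poly f [:P $ 2:]) (P $ 1) = 0}"

definition irreducible_plane_curve :: "nat \<Rightarrow> ('a::field ^ 2) set \<Rightarrow> bool" where
  "irreducible_plane_curve d C \<longleftrightarrow>
     (\<exists>f. Factorial_Ring.irreducible f \<and> total_deg f = d \<and> C = plane_zeros f)"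

end

theory Submission
  imports Defs "HOL-Analysis.Cartesian_Space"
begin

text \<open>
  Cut the curve \<open>f = 0\<close> with a pencil of parallel lines whose common direction \<open>(a, b)\<close> is a
  zero of the form of degree \<open>5\<close> in \<open>f\<close>, that is, project the curve from one of its points at
  infinity. One intersection point is then lost at infinity, so the intersection with the line of
  parameter \<open>u\<close> is governed by a polynomial \<open>H(u, v)\<close> of degree at most \<open>4\<close> in \<open>v\<close>
  (\<open>pencil_of_parallel_lines\<close>). Over \<open>F(t)\<close> the polynomial \<open>H(t, v)\<close> is solved by the formulas of
  Cardano and Ferrari (\<open>poly_degree_le_4_by_radicals\<close>), and each root \<open>r\<close> gives the
  parametrization \<open>t (a', b') + r (a, b)\<close>.

  The values of these parametrizations are controlled directly in the given valuation ring, whose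
  maximal ideal is prime in a strong sense: a product of elements of the ambient field lies in it
  only if a factor does. If \<open>r\<close> is regular at \<open>t0\<close>, then \<open>H(t0, r)\<close> lies in the maximal
  ideal; factoring \<open>H(t0, v)\<close> over the algebraically closed constant field shows that \<open>r\<close> has a
  residue and that it is a root of \<open>H(t0, v)\<close>, so the value is on the curve
  (\<open>root_specializes\<close>). Conversely let \<open>H(t0, v0) = 0\<close>. Then \<open>H(t, v0)\<close> lies in the maximal
  ideal; factoring \<open>H(t, v)\<close> over the closure of \<open>F(t)\<close> shows that some root \<open>r\<close> has residue
  \<open>v0\<close>, as long as the leading coefficient of \<open>H\<close> does not vanish at \<open>t0\<close>
  (\<open>root_lifts\<close>). Only the points on the finitely many lines where the leading coefficient
  vanishes can be missed.

  All this presupposes that no line of the pencil is contained in the curve. If one is, then by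
  irreducibility the curve is that line (\<open>irreducible_plane_zeros_line\<close>), which has a polynomial
  parametrization.
\<close>

section \<open>Subfields and subrings of a type-class field\<close>

lemma ring_of_type_algebra_sel [simp]:
  "carrier ring_of_type_algebra = UNIV"
  "x \<otimes>\<^bsub>ring_of_type_algebra\<^esub> y = x * y"
  "x \<oplus>\<^bsub>ring_of_type_algebra\<^esub> y = x + y"
  "\<one>\<^bsub>ring_of_type_algebra\<^esub> = 1"
  "\<zero>\<^bsub>ring_of_type_algebra\<^esub> = 0"
  by (simp_all add: ring_of_type_algebra_def)

lemma a_inv_ring_of_type_algebra [simp]:
  "\<ominus>\<^bsub>ring_of_type_algebra\<^esub> (x :: 'b::field) = - x"
proof -
  interpret field "ring_of_type_algebra :: 'b ring" by rule
  show ?thesis by (rule minus_equality) auto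
qed

lemma m_inv_ring_of_type_algebra:
  assumes "(x :: 'b::field) \<noteq> 0"
  shows "inv\<^bsub>ring_of_type_algebra\<^esub> x = inverse x"
proof -
  interpret field "ring_of_type_algebra :: 'b ring" by rule
  show ?thesis by (rule comm_inv_char) (use assms in auto)
qed

lemma subring_closed:
  fixes V :: "'b::field set"
  assumes "subring V ring_of_type_algebra"
  shows "0 \<in> V" "1 \<in> V" "x \<in> V \<Longrightarrow> - x \<in> V"
    "x \<in> V \<Longrightarrow> y \<in> V \<Longrightarrow> x + y \<in> V" "x \<in> V \<Longrightarrow> y \<in> V \<Longrightarrow> x - y \<in> V"
    "x \<in> V \<Longrightarrow> y \<in> V \<Longrightarrow> x * y \<in> V" "x \<in> V \<Longrightarrow> x ^ n \<in> V" "numeral k \<in> V"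
proof -
  interpret R: field "ring_of_type_algebra :: 'b ring" by rule
  note E = subringE[OF assms]
  show 0: "0 \<in> V" and 1: "1 \<in> V" using E by auto
  show m: "- x \<in> V" if "x \<in> V" for x using E(5)[OF that] by simp
  show a: "x + y \<in> V" if "x \<in> V" "y \<in> V" for x y using E(7)[OF that] by simp
  show t: "x * y \<in> V" if "x \<in> V" "y \<in> V" for x y using E(6)[OF that] by simp
  show "x - y \<in> V" if "x \<in> V" "y \<in> V" for x y using a[OF that(1) m[OF that(2)]] by simp
  show "x ^ n \<in> V" if "x \<in> V" for x by (induction n) (auto intro: 1 t that)
  have "of_nat n \<in> V" for n by (induction n) (auto intro: 0 1 a)
  from this[of "numeral k"] show "numeral k \<in> V" by simp
qed

lemma subfield_closed:
  fixes K :: "'b::field set"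
  assumes "subfield K ring_of_type_algebra"
  shows "0 \<in> K" "1 \<in> K" "x \<in> K \<Longrightarrow> - x \<in> K"
    "x \<in> K \<Longrightarrow> y \<in> K \<Longrightarrow> x + y \<in> K" "x \<in> K \<Longrightarrow> y \<in> K \<Longrightarrow> x - y \<in> K"
    "x \<in> K \<Longrightarrow> y \<in> K \<Longrightarrow> x * y \<in> K" "x \<in> K \<Longrightarrow> x ^ n \<in> K" "numeral k \<in> K"
    "x \<in> K \<Longrightarrow> inverse x \<in> K" "x \<in> K \<Longrightarrow> y \<in> K \<Longrightarrow> x / y \<in> K"
proof -
  interpret R: field "ring_of_type_algebra :: 'b ring" by rule
  note S = subring_closed[OF subfieldE(1)[OF assms]]
  show "0 \<in> K" "1 \<in> K" "x \<in> K \<Longrightarrow> - x \<in> K"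
    "x \<in> K \<Longrightarrow> y \<in> K \<Longrightarrow> x + y \<in> K" "x \<in> K \<Longrightarrow> y \<in> K \<Longrightarrow> x - y \<in> K"
    "x \<in> K \<Longrightarrow> y \<in> K \<Longrightarrow> x * y \<in> K" "x \<in> K \<Longrightarrow> x ^ n \<in> K" "numeral k \<in> K"
    using S by auto
  show i: "inverse x \<in> K" if "x \<in> K" for x
  proof (cases "x = 0")
    case False
    with R.subfield_m_inv(1)[OF assms, of x] that show ?thesis
      by (simp add: m_inv_ring_of_type_algebra)
  qed (use S in simp)
  show "x / y \<in> K" if "x \<in> K" "y \<in> K"
    using S(6)[OF that(1) i[OF that(2)]] by (simp add: divide_inverse)
qed

lemma subfield_generate_field:
  "subfield (generate_field ring_of_type_algebra A) (ring_of_type_algebra :: 'b::field ring)"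
proof -
  interpret R: field "ring_of_type_algebra :: 'b ring" by rule
  show ?thesis by (rule R.generate_field_is_subfield) simp
qed

lemma generate_field_least:
  fixes E :: "'b::field set"
  assumes "subfield E ring_of_type_algebra" "A \<subseteq> E"
  shows "generate_field ring_of_type_algebra A \<subseteq> E"
proof -
  interpret R: field "ring_of_type_algebra :: 'b ring" by rule
  show ?thesis by (rule R.generate_field_min_subfield1) (use assms in auto)
qed

section \<open>Equations of degree at most four\<close>

text \<open>
  Finite towers as in \<open>root_tower\<close>, seen only through their two end fields. Forgetting the
  intermediate fields makes composition of towers the transitivity of a relation.
\<close>

inductive radical_ext :: "'b::field set \<Rightarrow> 'b set \<Rightarrow> bool" for K where
  refl: "radical_ext K K"
| adjoin: "radical_ext K L \<Longrightarrow> l > 0 \<Longrightarrow> a \<in> L \<Longrightarrow> a \<noteq> 0 \<Longrightarrow>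
    radical_ext K (splitting_field_over L (Polynomial.monom 1 l - [:a:]))"

lemma radical_ext_trans:
  assumes "radical_ext L M" "radical_ext K L"
  shows "radical_ext K M"
  using assms by induction (auto intro: radical_ext.intros)

lemma radical_ext_mono: "radical_ext K L \<Longrightarrow> K \<subseteq> L"
  by (induction rule: radical_ext.induct)
     (auto simp: splitting_field_over_def intro: generate_field.incl)

lemma radical_ext_subfield:
  "radical_ext K L \<Longrightarrow> subfield K ring_of_type_algebra \<Longrightarrow> subfield L ring_of_type_algebra"
  by (induction rule: radical_ext.induct)
     (auto simp: splitting_field_over_def subfield_generate_field)

lemma radical_ext_chain:
  assumes "radical_ext K L"
  shows "\<exists>Ks. Ks \<noteq> [] \<and> Ks ! 0 = K \<and> last Ks = L \<and>
     (\<forall>i. Suc i < length Ks \<longrightarrow>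
        (\<exists>l a. l > 0 \<and> a \<in> Ks ! i \<and> a \<noteq> 0 \<and>
           Ks ! Suc i = splitting_field_over (Ks ! i) (Polynomial.monom 1 l - [:a:])))"
  using assms
proof induction
  case refl
  show ?case by (rule exI[of _ "[K]"]) auto
next
  case (adjoin L l a)
  let ?M = "splitting_field_over L (Polynomial.monom 1 l - [:a:])"
  from adjoin.IH obtain Ks where Ks: "Ks \<noteq> []" "Ks ! 0 = K" "last Ks = L"
    "\<And>i. Suc i < length Ks \<Longrightarrow>
        (\<exists>l a. l > 0 \<and> a \<in> Ks ! i \<and> a \<noteq> 0 \<and>
           Ks ! Suc i = splitting_field_over (Ks ! i) (Polynomial.monom 1 l - [:a:]))"
    by blast
  have "\<exists>l a. l > 0 \<and> a \<in> (Ks @ [?M]) ! i \<and> a \<noteq> 0 \<and>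
           (Ks @ [?M]) ! Suc i = splitting_field_over ((Ks @ [?M]) ! i) (Polynomial.monom 1 l - [:a:])"
    if "Suc i < length (Ks @ [?M])" for i
  proof (cases "Suc i < length Ks")
    case True
    thus ?thesis using Ks(4)[OF True] by (simp add: nth_append)
  next
    case False
    hence "i = length Ks - 1" "Suc i = length Ks" using that by auto
    hence "(Ks @ [?M]) ! i = L" "(Ks @ [?M]) ! Suc i = ?M"
      using Ks(1,3) by (auto simp: nth_append last_conv_nth)
    thus ?thesis using adjoin.hyps by auto
  qed
  thus ?case using Ks(1,2) by (intro exI[of _ "Ks @ [?M]"]) (auto simp: nth_append)
qed

text \<open>
  The form in which towers are built: once one value of \<open>a\<close> is available, all its \<open>l\<close>-th roots can
  be assumed to be. The separate case \<open>a = 0\<close> is the price of \<open>a \<noteq> 0\<close> in the definition.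
\<close>

lemma radical_ext_all_roots:
  assumes "subfield K ring_of_type_algebra" "a \<in> K" "l > 0"
  obtains L where "radical_ext K L" "\<And>z. z ^ l = a \<Longrightarrow> z \<in> L"
proof (cases "a = 0")
  case True
  show ?thesis
    by (rule that[OF radical_ext.refl]) (use True assms subfield_closed(1) in auto)
next
  case False
  let ?L = "splitting_field_over K (Polynomial.monom 1 l - [:a:])"
  show ?thesis
  proof (rule that)
    show "radical_ext K ?L" by (intro radical_ext.intros assms False)
    show "z \<in> ?L" if "z ^ l = a" for z
      unfolding splitting_field_over_def
      by (rule generate_field.incl) (use that in \<open>simp add: poly_monom\<close>)
  qed
qed

text \<open>
  In this and the following lemmas one extension \<open>L\<close> serves all roots \<open>x\<close> at once: the elements
  adjoined depend on the coefficients only. Here \<open>2 x + p\<close> is a square root of the discriminant.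
\<close>

lemma quadratic_by_radicals:
  fixes K :: "'b::field set"
  assumes K: "subfield K ring_of_type_algebra" and "p \<in> K" "q \<in> K" and two: "(2::'b) \<noteq> 0"
  obtains L where "radical_ext K L" "\<And>x. x ^ 2 + p * x + q = 0 \<Longrightarrow> x \<in> L"
proof -
  note C = subfield_closed[OF K]
  have "p ^ 2 - 4 * q \<in> K" by (intro C assms)
  from radical_ext_all_roots[OF K this, of 2]
  obtain L where L: "radical_ext K L" "\<And>z. z ^ 2 = p ^ 2 - 4 * q \<Longrightarrow> z \<in> L" by auto
  note D = subfield_closed[OF radical_ext_subfield[OF L(1) K]]
  show ?thesis
  proof (rule that[OF L(1)])
    fix x assume x: "x ^ 2 + p * x + q = 0"
    have "(2 * x + p) ^ 2 = p ^ 2 - 4 * q + 4 * (x ^ 2 + p * x + q)"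
      by (simp add: power2_eq_square algebra_simps)
    hence "2 * x + p \<in> L" using x L(2) by simp
    moreover have "p \<in> L" using \<open>p \<in> K\<close> radical_ext_mono[OF L(1)] by blast
    ultimately have "((2 * x + p) - p) / 2 \<in> L" by (simp only: D)
    thus "x \<in> L" using two by simp
  qed
qed

text \<open>
  Cardano's formula. Writing a root as \<open>x = w - r / w\<close> turns the equation into a quadratic one
  for \<open>w\<^sup>3\<close>, so it suffices to adjoin the roots \<open>Z1\<close>, \<open>Z2\<close> of that quadratic and then their
  cube roots.
\<close>

lemma depressed_cubic_by_radicals:
  fixes K :: "'b::alg_closed_field set"
  assumes K: "subfield K ring_of_type_algebra" and r: "r \<in> K" and q: "q \<in> K"
    and two: "(2::'b) \<noteq> 0"
  obtains L where "radical_ext K L" "\<And>x. x ^ 3 + 3 * r * x + q = 0 \<Longrightarrow> x \<in> L"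
proof -
  note C = subfield_closed[OF K]
  have "- (r ^ 3) \<in> K" by (intro C r)
  from quadratic_by_radicals[OF K q this two]
  obtain L1 where L1: "radical_ext K L1" "\<And>z. z ^ 2 + q * z + - (r ^ 3) = 0 \<Longrightarrow> z \<in> L1" by auto
  note F1 = radical_ext_subfield[OF L1(1) K]
  obtain Z1 where Z1: "Z1 ^ 2 + q * Z1 + - (r ^ 3) = 0"
    using alg_closed_imp_poly_has_root[of "[:- (r ^ 3), q, 1:]"]
    by (auto simp: algebra_simps power2_eq_square)
  have "Z1 \<in> L1" using L1(2) Z1 by blast
  define Z2 where "Z2 = - q - Z1"
  have "Z2 \<in> L1" unfolding Z2_def
    using subfield_closed[OF F1] \<open>Z1 \<in> L1\<close> q radical_ext_mono[OF L1(1)] by auto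
  from radical_ext_all_roots[OF F1 \<open>Z1 \<in> L1\<close>, of 3]
  obtain L2 where L2: "radical_ext L1 L2" "\<And>z. z ^ 3 = Z1 \<Longrightarrow> z \<in> L2" by auto
  note F2 = radical_ext_subfield[OF L2(1) F1]
  have "Z2 \<in> L2" using \<open>Z2 \<in> L1\<close> radical_ext_mono[OF L2(1)] by blast
  from radical_ext_all_roots[OF F2 this, of 3]
  obtain L where L3: "radical_ext L2 L" "\<And>z. z ^ 3 = Z2 \<Longrightarrow> z \<in> L" by auto
  note D = subfield_closed[OF radical_ext_subfield[OF L3(1) F2]]
  have KL: "radical_ext K L"
    using L1 L2 L3 radical_ext_trans by blast
  show ?thesis
  proof (rule that[OF KL])
    fix x assume x: "x ^ 3 + 3 * r * x + q = 0"
    \<comment> \<open>For \<open>r = 0\<close> a solution \<open>w = 0\<close> would lose \<open>x\<close>, so take the other one, \<open>w = x\<close>.\<close>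
    have "\<exists>w. w ^ 2 = x * w + r \<and> (w = 0 \<longrightarrow> x = 0)"
    proof (cases "r = 0")
      case True
      thus ?thesis by (intro exI[of _ x]) (simp add: power2_eq_square)
    next
      case False
      from alg_closed_imp_poly_has_root[of "[:- r, - x, 1:]"]
      obtain w where "w * (w - x) = r" by auto
      thus ?thesis using False
        by (intro exI[of _ w]) (auto simp: power2_eq_square algebra_simps)
    qed
    then obtain w where w: "w ^ 2 = x * w + r" "w = 0 \<Longrightarrow> x = 0" by blast
    have xw: "x * w = w ^ 2 - r" using w by simp
    have "(x ^ 3 + 3 * r * x + q) * w ^ 3 = (x * w) ^ 3 + 3 * r * (x * w) * w ^ 2 + q * w ^ 3"
      by (simp add: algebra_simps power3_eq_cube power2_eq_square)
    also have "\<dots> = (w ^ 3) ^ 2 + q * w ^ 3 - r ^ 3"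
      unfolding xw by (simp add: algebra_simps power3_eq_cube power2_eq_square)
    finally have Z: "(w ^ 3) ^ 2 + q * w ^ 3 - r ^ 3 = 0" using x by simp
    have "(w ^ 3 - Z1) * (w ^ 3 - Z2) = ((w ^ 3) ^ 2 + q * w ^ 3 - r ^ 3) - (Z1 ^ 2 + q * Z1 + - (r ^ 3))"
      unfolding Z2_def by (simp add: algebra_simps power2_eq_square)
    also have "\<dots> = 0" using Z Z1 by simp
    finally have "w ^ 3 = Z1 \<or> w ^ 3 = Z2" by simp
    hence "w \<in> L" using L2(2) L3(2) radical_ext_mono[OF L3(1)] by blast
    moreover have "r \<in> L" using r radical_ext_mono[OF KL] by blast
    ultimately have "w - r / w \<in> L" by (intro D)
    moreover have "x = w - r / w" if "w \<noteq> 0"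
      using that w(1) by (simp add: field_simps power2_eq_square)
    ultimately show "x \<in> L" using w(2) D(1) by (cases "w = 0") auto
  qed
qed

text \<open>
  Shifting \<open>x\<close> by a third of the quadratic coefficient removes the quadratic term.
\<close>

lemma cubic_by_radicals:
  fixes K :: "'b::alg_closed_field set"
  assumes K: "subfield K ring_of_type_algebra" and b: "b \<in> K" and c: "c \<in> K" and d: "d \<in> K"
    and two: "(2::'b) \<noteq> 0" and three: "(3::'b) \<noteq> 0"
  obtains L where "radical_ext K L" "\<And>x. x ^ 3 + b * x ^ 2 + c * x + d = 0 \<Longrightarrow> x \<in> L"
proof -
  note C = subfield_closed[OF K]
  define e where "e = b / 3"
  have be: "b = 3 * e" using three by (simp add: e_def)
  have e: "e \<in> K" unfolding e_def by (intro C b)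
  have r: "c / 3 - e ^ 2 \<in> K" by (intro C c e)
  have q: "2 * e ^ 3 - e * c + d \<in> K" by (intro C c e d)
  from depressed_cubic_by_radicals[OF K r q two]
  obtain L where L: "radical_ext K L"
    "\<And>x. x ^ 3 + 3 * (c / 3 - e ^ 2) * x + (2 * e ^ 3 - e * c + d) = 0 \<Longrightarrow> x \<in> L" by blast
  note D = subfield_closed[OF radical_ext_subfield[OF L(1) K]]
  show ?thesis
  proof (rule that[OF L(1)])
    fix x assume x: "x ^ 3 + b * x ^ 2 + c * x + d = 0"
    have t: "3 * (c / 3 - e ^ 2) = c - 3 * e ^ 2" using three by (simp add: algebra_simps)
    have "(x + e) ^ 3 + 3 * (c / 3 - e ^ 2) * (x + e) + (2 * e ^ 3 - e * c + d)
        = x ^ 3 + b * x ^ 2 + c * x + d"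
      unfolding t be by (simp add: algebra_simps power2_eq_square power3_eq_cube)
    hence "x + e \<in> L" using x L(2) by simp
    moreover have "e \<in> L" using e radical_ext_mono[OF L(1)] by blast
    ultimately have "(x + e) - e \<in> L" by (simp only: D)
    thus "x \<in> L" by simp
  qed
qed

text \<open>
  Ferrari's method. If \<open>s\<^sup>2 = 2 m\<close>, \<open>s e = q\<close> and \<open>e\<^sup>2 = (p + m)\<^sup>2 - r\<close>, then the quartic is the
  difference of squares \<open>(x\<^sup>2 + p + m)\<^sup>2 - (s x - e)\<^sup>2\<close>, hence a product of two quadratics.
  Eliminating \<open>s\<close> and \<open>e\<close> gives the resolvent cubic for \<open>m\<close>.
\<close>

lemma depressed_quartic_by_radicals:
  fixes K :: "'b::alg_closed_field set"
  assumes K: "subfield K ring_of_type_algebra" and p: "p \<in> K" and q: "q \<in> K" and r: "r \<in> K"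
    and two: "(2::'b) \<noteq> 0" and three: "(3::'b) \<noteq> 0"
  obtains L where "radical_ext K L" "\<And>x. x ^ 4 + 2 * p * x ^ 2 + 2 * q * x + r = 0 \<Longrightarrow> x \<in> L"
proof -
  note C = subfield_closed[OF K]
  have "\<exists>L m s e. radical_ext K L \<and> m \<in> L \<and> s \<in> L \<and> e \<in> L \<and>
          s ^ 2 = 2 * m \<and> s * e = q \<and> e ^ 2 = (p + m) ^ 2 - r"
  proof (cases "q = 0")
    case True
    \<comment> \<open>In the biquadratic case the resolvent may have no nonzero root, and \<open>m = s = 0\<close> works.\<close>
    have "p ^ 2 - r \<in> K" by (intro C p r)
    from radical_ext_all_roots[OF K this, of 2]
    obtain L where L: "radical_ext K L" "\<And>z. z ^ 2 = p ^ 2 - r \<Longrightarrow> z \<in> L" by auto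
    note D = subfield_closed[OF radical_ext_subfield[OF L(1) K]]
    obtain e where "e ^ 2 = p ^ 2 - r" using nth_root_exists[of 2 "p ^ 2 - r"] by auto
    thus ?thesis using True L D(1)
      by (intro exI[of _ L] exI[of _ 0] exI[of _ e]) auto
  next
    case False
    have c: "2 * p \<in> K" "p ^ 2 - r \<in> K" "- (q ^ 2) / 2 \<in> K" by (intro C p q r)+
    from cubic_by_radicals[OF K c two three]
    obtain L1 where L1: "radical_ext K L1"
      "\<And>x. x ^ 3 + 2 * p * x ^ 2 + (p ^ 2 - r) * x + - (q ^ 2) / 2 = 0 \<Longrightarrow> x \<in> L1" by blast
    note F1 = radical_ext_subfield[OF L1(1) K]
    obtain m where m: "m ^ 3 + 2 * p * m ^ 2 + (p ^ 2 - r) * m + - (q ^ 2) / 2 = 0"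
      using alg_closed_imp_poly_has_root[of "[:- (q ^ 2) / 2, p ^ 2 - r, 2 * p, 1:]"]
      by (auto simp: algebra_simps power2_eq_square power3_eq_cube)
    have "m \<in> L1" using L1(2) m by blast
    hence "2 * m \<in> L1" using subfield_closed(6,8)[OF F1] by simp
    from radical_ext_all_roots[OF F1 this, of 2]
    obtain L where L: "radical_ext L1 L" "\<And>z. z ^ 2 = 2 * m \<Longrightarrow> z \<in> L" by auto
    note D = subfield_closed[OF radical_ext_subfield[OF L(1) F1]]
    obtain s where s: "s ^ 2 = 2 * m" using nth_root_exists[of 2 "2 * m"] by auto
    have KL: "radical_ext K L" using L1 L radical_ext_trans by blast
    have "m \<noteq> 0" using m False two by auto
    hence "s \<noteq> 0" using s two by auto
    define e where "e = q / s"
    have "s \<in> L" using L(2) s by blast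
    moreover have "m \<in> L" using \<open>m \<in> L1\<close> radical_ext_mono[OF L(1)] by blast
    moreover have "e \<in> L" unfolding e_def
      using q radical_ext_mono[OF KL] \<open>s \<in> L\<close> by (intro D) auto
    moreover have se: "s * e = q" using \<open>s \<noteq> 0\<close> by (simp add: e_def)
    moreover have "e ^ 2 = (p + m) ^ 2 - r"
    proof -
      have "2 * m * e ^ 2 = q ^ 2" using se s by (metis power_mult_distrib)
      also have "\<dots> = 2 * (q ^ 2 / 2)" using two by simp
      also have "q ^ 2 / 2 = m ^ 3 + 2 * p * m ^ 2 + (p ^ 2 - r) * m"
        using m by (metis minus_divide_left add_uminus_conv_diff eq_iff_diff_eq_0)
      also have "2 * \<dots> = 2 * m * ((p + m) ^ 2 - r)"
        by (simp add: algebra_simps power2_eq_square power3_eq_cube)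
      finally show ?thesis using \<open>m \<noteq> 0\<close> two by simp
    qed
    ultimately show ?thesis using KL s by blast
  qed
  then obtain L m s e where L: "radical_ext K L" and mse: "m \<in> L" "s \<in> L" "e \<in> L"
    and eqs: "s ^ 2 = 2 * m" "s * e = q" "e ^ 2 = (p + m) ^ 2 - r" by blast
  note F = radical_ext_subfield[OF L K]
  note D = subfield_closed[OF F]
  have pL: "p \<in> L" using p radical_ext_mono[OF L] by blast
  have c1: "- s \<in> L" "p + m + e \<in> L" by (intro D mse pL)+
  from quadratic_by_radicals[OF F c1 two]
  obtain L1 where L1: "radical_ext L L1" "\<And>x. x ^ 2 + - s * x + (p + m + e) = 0 \<Longrightarrow> x \<in> L1" by blast
  have c2: "s \<in> L1" "p + m - e \<in> L1" using D mse pL radical_ext_mono[OF L1(1)] by auto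
  from quadratic_by_radicals[OF radical_ext_subfield[OF L1(1) F] c2 two]
  obtain L2 where L2: "radical_ext L1 L2" "\<And>x. x ^ 2 + s * x + (p + m - e) = 0 \<Longrightarrow> x \<in> L2" by blast
  show ?thesis
  proof (rule that)
    show "radical_ext K L2" using L L1 L2 radical_ext_trans by blast
    fix x assume x: "x ^ 4 + 2 * p * x ^ 2 + 2 * q * x + r = 0"
    have "(x ^ 2 + - s * x + (p + m + e)) * (x ^ 2 + s * x + (p + m - e))
        = x ^ 4 + 2 * (p + m) * x ^ 2 + (p + m) ^ 2 - s ^ 2 * x ^ 2 + 2 * (s * e) * x - e ^ 2"
      by (simp add: algebra_simps power2_eq_square power4_eq_xxxx)
    also have "\<dots> = x ^ 4 + 2 * p * x ^ 2 + 2 * q * x + r"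
      unfolding eqs by (simp add: algebra_simps)
    finally have "x ^ 2 + - s * x + (p + m + e) = 0 \<or> x ^ 2 + s * x + (p + m - e) = 0"
      using x by simp
    thus "x \<in> L2" using L1(2) L2(2) radical_ext_mono[OF L2(1)] by blast
  qed
qed

lemma quartic_by_radicals:
  fixes K :: "'b::alg_closed_field set"
  assumes K: "subfield K ring_of_type_algebra"
    and b: "b \<in> K" and c: "c \<in> K" and d: "d \<in> K" and k: "k \<in> K"
    and two: "(2::'b) \<noteq> 0" and three: "(3::'b) \<noteq> 0"
  obtains L where "radical_ext K L"
    "\<And>x. x ^ 4 + b * x ^ 3 + c * x ^ 2 + d * x + k = 0 \<Longrightarrow> x \<in> L"
proof -
  note C = subfield_closed[OF K]
  have "(2::'b) * 2 \<noteq> 0" by (intro no_zero_divisors two)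
  hence four: "(4::'b) \<noteq> 0" by simp
  define e where "e = b / 4"
  have be: "b = 4 * e" using four by (simp add: e_def)
  have e: "e \<in> K" unfolding e_def by (intro C b)
  let ?p = "c / 2 - 3 * e ^ 2" and ?q = "4 * e ^ 3 - c * e + d / 2"
    and ?r = "k - d * e + c * e ^ 2 - 3 * e ^ 4"
  have pK: "?p \<in> K" and qK: "?q \<in> K" and rK: "?r \<in> K" by (intro C b c d k e)+
  from depressed_quartic_by_radicals[OF K pK qK rK two three]
  obtain L where L: "radical_ext K L"
    "\<And>x. x ^ 4 + 2 * ?p * x ^ 2 + 2 * ?q * x + ?r = 0 \<Longrightarrow> x \<in> L" by blast
  note D = subfield_closed[OF radical_ext_subfield[OF L(1) K]]
  show ?thesis
  proof (rule that[OF L(1)])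
    fix x assume x: "x ^ 4 + b * x ^ 3 + c * x ^ 2 + d * x + k = 0"
    have t: "2 * ?p = c - 6 * e ^ 2" "2 * ?q = 8 * e ^ 3 - 2 * c * e + d"
      using two by (simp_all add: algebra_simps)
    have "(x + e) ^ 4 + 2 * ?p * (x + e) ^ 2 + 2 * ?q * (x + e) + ?r
        = x ^ 4 + b * x ^ 3 + c * x ^ 2 + d * x + k"
      unfolding t be by (simp add: algebra_simps power2_eq_square power3_eq_cube power4_eq_xxxx)
    hence "x + e \<in> L" using x L(2) by simp
    moreover have "e \<in> L" using e radical_ext_mono[OF L(1)] by blast
    ultimately have "(x + e) - e \<in> L" by (simp only: D)
    thus "x \<in> L" by simp
  qed
qed

text \<open>
  Multiplication by a power of \<open>x\<close> and a constant reduces all lower degrees to monic quartics; the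
  additional root \<open>0\<close> does no harm.
\<close>

lemma poly_degree_le_4_by_radicals:
  fixes K :: "'b::alg_closed_field set"
  assumes K: "subfield K ring_of_type_algebra" and co: "\<And>i. Polynomial.coeff h i \<in> K"
    and deg: "Polynomial.degree h \<le> 4" and "h \<noteq> 0"
    and two: "(2::'b) \<noteq> 0" and three: "(3::'b) \<noteq> 0"
  obtains L where "radical_ext K L" "\<And>x. poly h x = 0 \<Longrightarrow> x \<in> L"
proof -
  note C = subfield_closed[OF K]
  let ?n = "Polynomial.degree h" and ?c = "Polynomial.lead_coeff h"
  define g where "g = Polynomial.monom (inverse ?c) (4 - ?n) * h"
  have gK: "Polynomial.coeff g i \<in> K" for i
    unfolding g_def coeff_monom_mult using C co by simp
  have g4: "Polynomial.coeff g 4 = 1"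
    unfolding g_def coeff_monom_mult using deg \<open>h \<noteq> 0\<close> by simp
  have "Polynomial.degree g \<le> 4"
    unfolding g_def using degree_mult_le[of "Polynomial.monom (inverse ?c) (4 - ?n)" h]
      degree_monom_le[of "inverse ?c" "4 - ?n"] deg by linarith
  hence pg: "poly g x = (\<Sum>i\<le>4. Polynomial.coeff g i * x ^ i)" for x
    unfolding poly_altdef by (intro sum.mono_neutral_left) (auto simp: coeff_eq_0)
  from quartic_by_radicals[OF K gK[of 3] gK[of 2] gK[of 1] gK[of 0] two three]
  obtain L where L: "radical_ext K L" "\<And>x. x ^ 4 + Polynomial.coeff g 3 * x ^ 3 + Polynomial.coeff g 2 * x ^ 2 + Polynomial.coeff g 1 * x + Polynomial.coeff g 0 = 0 \<Longrightarrow> x \<in> L"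
    by blast
  show ?thesis
  proof (rule that[OF L(1)])
    fix x assume "poly h x = 0"
    hence "poly g x = 0" by (simp add: g_def)
    moreover have "{..4} = {0, 1, 2, 3, 4 :: nat}" by auto
    ultimately show "x \<in> L" unfolding pg
      by (intro L(2)) (simp add: g4 algebra_simps)
  qed
qed

section \<open>Polynomials and constants inside the closure of the rational function field\<close>

definition poly_emb :: "'a::field poly \<Rightarrow> 'a ratfun_closure" where
  "poly_emb p = to_ac (Fract p 1)"

lemma poly_emb_hom [simp]:
  "poly_emb 0 = 0" "poly_emb 1 = 1"
  "poly_emb (p + q) = poly_emb p + poly_emb q"
  "poly_emb (p - q) = poly_emb p - poly_emb q"
  "poly_emb (p * q) = poly_emb p * poly_emb q"
  by (simp_all add: poly_emb_def fract_collapse flip: to_ac_add to_ac_diff to_ac_mult)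

lemma poly_emb_eq_0_iff [simp]: "poly_emb p = 0 \<longleftrightarrow> p = 0"
proof
  assume "poly_emb p = 0"
  hence "Fract p 1 = Fract 0 (1 :: 'a poly)"
    using to_ac_eq_0_iff by (metis poly_emb_def Zero_fract_def)
  thus "p = 0" by (simp add: eq_fract)
qed auto

lemma const_emb_eq: "const_emb c = poly_emb [:c:]"
  and param_var_eq: "param_var = poly_emb [:0, 1:]"
  by (simp_all add: const_emb_def param_var_def poly_emb_def)

lemma const_emb_hom [simp]:
  "const_emb 0 = 0" "const_emb 1 = 1"
  "const_emb (c + d) = const_emb c + const_emb d"
  "const_emb (c - d) = const_emb c - const_emb d"
  "const_emb (c * d) = const_emb c * const_emb d"
  unfolding const_emb_eq
  by (simp_all flip: poly_emb_hom(2-) add: one_pCons mult.commute)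

lemma const_emb_eq_0_iff [simp]: "const_emb c = 0 \<longleftrightarrow> c = 0"
  by (simp add: const_emb_eq)

lemma const_emb_minus [simp]: "const_emb (- c) = - const_emb c"
  using const_emb_hom(4)[of 0 c] by simp

lemma const_emb_inverse: "const_emb (inverse c) = inverse (const_emb c)"
proof (cases "c = 0")
  case False
  hence "const_emb (inverse c) * const_emb c = 1"
    by (simp flip: const_emb_hom)
  thus ?thesis using False by (metis inverse_unique mult.commute)
qed simp

lemma const_emb_of_nat: "const_emb (of_nat n) = of_nat n"
  by (induction n) auto

text \<open>
  This is what keeps the parametrizations below from being constant.
\<close>

lemma param_var_transcendental:
  assumes "const_emb c * param_var = const_emb d"
  shows "c = 0"
proof -
  have "poly_emb ([:c:] * [:0, 1:] - [:d:]) = 0"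
    using assms unfolding const_emb_eq param_var_eq by (simp only: poly_emb_hom diff_self)
  thus "c = 0" by (simp only: poly_emb_eq_0_iff) simp
qed

lemma poly_map_poly_hom_mult:
  fixes \<phi> :: "'a::comm_ring_1 \<Rightarrow> 'b::comm_ring_1"
  assumes 0: "\<phi> 0 = 0" and add: "\<And>a b. \<phi> (a + b) = \<phi> a + \<phi> b"
    and mult: "\<And>a b. \<phi> (a * b) = \<phi> a * \<phi> b"
  shows "map_poly \<phi> (p * q) = map_poly \<phi> p * map_poly \<phi> q"
proof (rule poly_eqI)
  fix n
  have sum: "\<phi> (sum f A) = (\<Sum>i\<in>A. \<phi> (f i))" if "finite A" for f and A :: "nat set"
    using that by induction (auto simp: 0 add)
  show "Polynomial.coeff (map_poly \<phi> (p * q)) n = Polynomial.coeff (map_poly \<phi> p * map_poly \<phi> q) n"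
    by (simp add: coeff_map_poly coeff_mult 0 sum mult)
qed

lemma poly_map_poly_hom:
  fixes \<phi> :: "'a::comm_ring_1 \<Rightarrow> 'b::comm_ring_1"
  assumes 0: "\<phi> 0 = 0" and add: "\<And>a b. \<phi> (a + b) = \<phi> a + \<phi> b"
    and mult: "\<And>a b. \<phi> (a * b) = \<phi> a * \<phi> b"
  shows "poly (map_poly \<phi> p) (\<phi> x) = \<phi> (poly p x)"
  by (induction p) (simp_all add: 0 add mult map_poly_pCons)

lemma poly_linear_prod_mset:
  "poly (\<Prod>x\<in>#A. [:- x, 1:]) y = (\<Prod>x\<in>#A. y - x)" for y :: "'b::comm_ring_1"
  by (simp add: poly_prod_mset)

section \<open>Reduction modulo a place\<close>

locale ratfun_place =
  fixes t0 :: "'a::{alg_closed_field, field_char_0}" and V :: "'a ratfun_closure set"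
  assumes place: "place_over t0 V"
begin

abbreviation "\<mm> \<equiv> valuation_ideal V"

lemma subringV: "subring V ring_of_type_algebra"
  using place by (simp add: place_over_def valuation_subring_def)

lemmas V_closed = subring_closed[OF subringV]

lemma valuation: "x \<in> V \<or> inverse x \<in> V"
  using place V_closed(1) by (cases "x = 0") (auto simp: place_over_def valuation_subring_def)

lemma const_in_V: "const_emb c \<in> V"
  using place by (auto simp: place_over_def)

lemma ideal_subset: "x \<in> \<mm> \<Longrightarrow> x \<in> V"
  by (simp add: valuation_ideal_def)

lemma zero_in_ideal: "0 \<in> \<mm>"
  by (simp add: valuation_ideal_def V_closed)

lemma one_notin_ideal: "1 \<notin> \<mm>"
  by (simp add: valuation_ideal_def V_closed)

lemma notin_ideal: "x \<notin> \<mm> \<longleftrightarrow> x \<noteq> 0 \<and> inverse x \<in> V"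
  using valuation[of x] V_closed(1) by (auto simp: valuation_ideal_def)

text \<open>
  The factors range over the whole field: if neither lies in the ideal, both have their inverse in
  \<open>V\<close>, and so has the product. A product of differences \<open>v - r\<close> can therefore be handled before
  the roots \<open>r\<close> are known to be regular.
\<close>

lemma ideal_prime:
  assumes "x * y \<in> \<mm>"
  shows "x \<in> \<mm> \<or> y \<in> \<mm>"
proof (rule ccontr)
  assume "\<not> ?thesis"
  hence "x \<noteq> 0" "y \<noteq> 0" "inverse x * inverse y \<in> V"
    using V_closed(6) by (simp_all add: notin_ideal)
  hence "x * y \<notin> \<mm>" by (simp add: notin_ideal)
  with assms show False by contradiction
qed

lemma ideal_prime_prod_mset:
  "(\<Prod>x\<in>#A. f x) \<in> \<mm> \<Longrightarrow> \<exists>x\<in>#A. f x \<in> \<mm>"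
proof (induction A)
  case (add x A)
  hence "f x * (\<Prod>x\<in>#A. f x) \<in> \<mm>" by simp
  from ideal_prime[OF this] add.IH show ?case by auto
qed (simp add: one_notin_ideal)

lemma ideal_mult:
  assumes "x \<in> \<mm>" "v \<in> V"
  shows "v * x \<in> \<mm>"
proof (rule ccontr)
  assume "v * x \<notin> \<mm>"
  hence "v * x \<noteq> 0" "inverse (v * x) \<in> V" using notin_ideal by auto
  moreover from this have "v * inverse (v * x) \<in> V" using V_closed(6)[OF assms(2)] by blast
  moreover have "v * inverse (v * x) = inverse x" if "v \<noteq> 0"
    using that by (simp add: mult.assoc[symmetric])
  ultimately have "inverse x \<in> V" "x \<noteq> 0" by (metis mult_zero_left, metis mult_zero_right)
  hence "x \<notin> \<mm>" by (simp add: notin_ideal)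
  with assms(1) show False by contradiction
qed

text \<open>
  Of two nonzero elements one divides the other in \<open>V\<close>, so their sum is a multiple of one of them.
\<close>

lemma ideal_add:
  assumes "x \<in> \<mm>" "y \<in> \<mm>"
  shows "x + y \<in> \<mm>"
proof -
  have *: "x + y \<in> \<mm>" if "y \<in> \<mm>" "y \<noteq> 0" "x / y \<in> V" for x y
  proof -
    have "(x / y + 1) * y \<in> \<mm>" by (intro ideal_mult that V_closed)
    thus ?thesis using that(2) by (simp add: field_simps)
  qed
  show ?thesis
  proof (cases "x = 0 \<or> y = 0")
    case False
    hence "x / y \<in> V \<or> y / x \<in> V" using valuation[of "x / y"] by simp
    thus ?thesis using False *[of y x] *[of x y] assms by (metis add.commute)
  qed (use assms in auto)
qed

lemma ideal_uminus: "x \<in> \<mm> \<Longrightarrow> - x \<in> \<mm>"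
  using ideal_mult[of x "- 1"] V_closed(3)[OF V_closed(2)] by simp

lemma ideal_diff: "x \<in> \<mm> \<Longrightarrow> y \<in> \<mm> \<Longrightarrow> x - y \<in> \<mm>"
  using ideal_add[of x "- y"] ideal_uminus by simp

lemma const_in_ideal_iff: "const_emb c \<in> \<mm> \<longleftrightarrow> c = 0"
proof
  assume "const_emb c \<in> \<mm>"
  moreover have "inverse (const_emb c) \<in> V"
    using const_in_V[of "inverse c"] by (simp only: const_emb_inverse)
  ultimately show "c = 0" using notin_ideal[of "const_emb c"] by simp
qed (simp add: zero_in_ideal)

lemma residue_eqI:
  assumes "S - const_emb c \<in> \<mm>"
  shows "residue_at V S = c"
  unfolding residue_at_def
proof (rule the_equality)
  fix d assume "S - const_emb d \<in> \<mm>"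
  from ideal_diff[OF this assms] have "const_emb (c - d) \<in> \<mm>" by simp
  thus "d = c" by (simp only: const_in_ideal_iff) simp
qed (fact assms)

lemma param_minus_const: "param_var - const_emb t0 \<in> \<mm>"
  using place by (simp add: place_over_def)

lemma param_in_V: "param_var \<in> V"
  using V_closed(4)[OF ideal_subset[OF param_minus_const] const_in_V[of t0]] by simp

lemma poly_emb_in_V: "poly_emb p \<in> V"
proof (induction p)
  case (pCons a p)
  have "pCons a p = [:a:] + [:0, 1:] * p" by simp
  hence "poly_emb (pCons a p) = const_emb a + param_var * poly_emb p"
    by (metis poly_emb_hom(3,5) const_emb_eq param_var_eq)
  thus ?case using pCons V_closed(4,6) const_in_V param_in_V by simp
qed (simp add: V_closed)

text \<open>
  Reduction modulo the place sends \<open>p(t)\<close> to \<open>p(t0)\<close>, because \<open>t - t0\<close> divides \<open>p(t) - p(t0)\<close>.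
\<close>

lemma poly_emb_residue: "poly_emb p - const_emb (poly p t0) \<in> \<mm>"
proof -
  have "poly (p - [:poly p t0:]) t0 = 0" by simp
  then obtain q where "p - [:poly p t0:] = [:- t0, 1:] * q"
    unfolding poly_eq_0_iff_dvd by blast
  also have "[:- t0, 1:] = [:0, 1:] - [:t0:]" by simp
  finally have "poly_emb p - const_emb (poly p t0) = poly_emb q * (param_var - const_emb t0)"
    by (metis poly_emb_hom(4,5) const_emb_eq param_var_eq mult.commute)
  thus ?thesis using ideal_mult[OF param_minus_const poly_emb_in_V] by simp
qed

text \<open>
  Here \<open>H\<close> is a family of polynomials with parameter \<open>t\<close>, and \<open>map_poly (\<lambda>p. poly p t0) H\<close> is
  its member at \<open>t0\<close>. Modulo the place, the generic member and the member at \<open>t0\<close> agree at every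
  regular argument.
\<close>

lemma family_residue:
  assumes "r \<in> V"
  shows "poly (map_poly poly_emb H) r - poly (map_poly const_emb (map_poly (\<lambda>p. poly p t0) H)) r \<in> \<mm>"
proof (induction H)
  case (pCons p H)
  let ?h = "poly (map_poly poly_emb H) r"
    and ?g = "poly (map_poly const_emb (map_poly (\<lambda>p. poly p t0) H)) r"
  have "(poly_emb p - const_emb (poly p t0)) + r * (?h - ?g) \<in> \<mm>"
    by (intro ideal_add ideal_mult poly_emb_residue pCons assms)
  thus ?case by (simp add: map_poly_pCons algebra_simps)
qed (simp add: zero_in_ideal)

text \<open>
  Split off the linear factors of \<open>G\<close> over the constants and apply \<open>ideal_prime\<close>; the remaining
  constant is a unit of \<open>V\<close>.
\<close>

lemma near_root:
  assumes "G \<noteq> 0" "poly (map_poly const_emb G) r \<in> \<mm>"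
  shows "\<exists>c. poly G c = 0 \<and> r - const_emb c \<in> \<mm>"
  using assms
proof (induction "Polynomial.degree G" arbitrary: G)
  case 0
  then obtain a where "G = [:a:]" by (metis degree_eq_zeroE)
  thus ?case using 0 by (simp add: map_poly_pCons const_in_ideal_iff)
next
  case (Suc n)
  then obtain c where c: "poly G c = 0" using alg_closed_imp_poly_has_root[of G] by auto
  then obtain G' where G: "G = [:- c, 1:] * G'" unfolding poly_eq_0_iff_dvd by blast
  have "G' \<noteq> 0" using G Suc by auto
  hence "Polynomial.degree G = Suc (Polynomial.degree G')"
    unfolding G by (subst degree_mult_eq) auto
  with Suc have deg: "n = Polynomial.degree G'" by simp
  have "poly (map_poly const_emb G) r = (r - const_emb c) * poly (map_poly const_emb G') r"
    unfolding G by (subst poly_map_poly_hom_mult) (simp_all add: map_poly_pCons algebra_simps)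
  with Suc ideal_prime have "r - const_emb c \<in> \<mm> \<or> poly (map_poly const_emb G') r \<in> \<mm>" by metis
  thus ?case
    using c Suc.hyps(1)[OF deg \<open>G' \<noteq> 0\<close>] by (auto simp: G)
qed

text \<open>
  Besides identifying the residue of \<open>r\<close>, this shows that it exists, which for a general element of
  \<open>V\<close> would require the residue field to be algebraic over the constants.
\<close>

lemma root_specializes:
  assumes "poly (map_poly poly_emb H) r = 0" "r \<in> V" "map_poly (\<lambda>p. poly p t0) H \<noteq> 0"
  obtains c where "r - const_emb c \<in> \<mm>" "poly (map_poly (\<lambda>p. poly p t0) H) c = 0"
proof -
  have "poly (map_poly const_emb (map_poly (\<lambda>p. poly p t0) H)) r \<in> \<mm>"
    using ideal_uminus[OF family_residue[OF assms(2), of H]] assms(1) by simp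
  from near_root[OF assms(3) this] that show thesis by blast
qed

text \<open>
  Modulo the place, \<open>H(t, v)\<close> equals \<open>H(t0, v) = 0\<close>. On the other hand it is the leading coefficient
  times the product of the \<open>v - r\<close> over the roots \<open>r\<close> of the generic member, and the leading
  coefficient is a unit at \<open>t0\<close>; so one of the factors lies in the maximal ideal.
\<close>

lemma root_lifts:
  assumes "poly (map_poly (\<lambda>p. poly p t0) H) v = 0" "poly (Polynomial.lead_coeff H) t0 \<noteq> 0"
  obtains r where "poly (map_poly poly_emb H) r = 0" "r - const_emb v \<in> \<mm>"
proof -
  let ?h = "map_poly poly_emb H"
  have "H \<noteq> 0" using assms(2) by auto
  hence h: "?h \<noteq> 0" "Polynomial.lead_coeff ?h = poly_emb (Polynomial.lead_coeff H)"
    by (simp_all add: map_poly_eq_0_iff degree_map_poly coeff_map_poly)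
  then obtain A where A: "?h = smult (poly_emb (Polynomial.lead_coeff H)) (\<Prod>x\<in>#A. [:- x, 1:])"
    using alg_closed_imp_factorization[of ?h] by auto
  have ev: "poly ?h y = poly_emb (Polynomial.lead_coeff H) * (\<Prod>x\<in>#A. y - x)" for y
    by (subst A) (simp add: poly_linear_prod_mset)
  have "poly (map_poly const_emb (map_poly (\<lambda>p. poly p t0) H)) (const_emb v) = 0"
    by (subst poly_map_poly_hom) (simp_all add: assms(1))
  hence "poly ?h (const_emb v) \<in> \<mm>" using family_residue[OF const_in_V[of v], of H] by simp
  hence "poly_emb (Polynomial.lead_coeff H) * (\<Prod>x\<in>#A. const_emb v - x) \<in> \<mm>" by (simp add: ev)
  moreover have "poly_emb (Polynomial.lead_coeff H) \<notin> \<mm>"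
  proof
    assume "poly_emb (Polynomial.lead_coeff H) \<in> \<mm>"
    from ideal_diff[OF this poly_emb_residue[of "Polynomial.lead_coeff H"]]
    have "const_emb (poly (Polynomial.lead_coeff H) t0) \<in> \<mm>" by simp
    thus False using assms(2) by (simp only: const_in_ideal_iff)
  qed
  ultimately obtain x where x: "x \<in># A" "const_emb v - x \<in> \<mm>"
    using ideal_prime ideal_prime_prod_mset by blast
  show thesis
  proof (rule that)
    show "poly ?h x = 0" unfolding ev using x(1) by (auto simp: prod_mset_zero_iff)
    show "x - const_emb v \<in> \<mm>" using ideal_uminus[OF x(2)] by simp
  qed
qed

end

section \<open>Root towers over the rational function field\<close>

lemma subfield_ratfun: "subfield (ratfun_subfield :: 'a::field ratfun_closure set) ring_of_type_algebra"
proof -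
  let ?E = "generate_field ring_of_type_algebra (ratfun_subfield :: 'a ratfun_closure set)"
  have "x \<in> ratfun_subfield" if "x \<in> ?E" for x
    using that
  proof induction
    case one show ?case by (auto simp: ratfun_subfield_def intro: range_eqI[of _ _ 1])
  next
    case (m_inv x) thus ?case
      by (auto simp: m_inv_ring_of_type_algebra ratfun_subfield_def simp flip: to_ac_inverse)
  qed (auto simp: ratfun_subfield_def simp flip: to_ac_minus to_ac_add to_ac_mult)
  hence "?E = ratfun_subfield" by (auto intro: generate_field.incl)
  thus ?thesis using subfield_generate_field by metis
qed

lemma root_tower_degree_le_4:
  fixes g :: "'a::field_char_0 ratfun poly"
  assumes "g \<noteq> 0" "Polynomial.degree g \<le> 4"
  obtains Ks where "root_tower g Ks" "subfield (last Ks) ring_of_type_algebra"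
    "ratfun_subfield \<subseteq> last Ks" "\<And>x. poly (map_poly to_ac g) x = 0 \<Longrightarrow> x \<in> last Ks"
proof -
  let ?h = "map_poly to_ac g"
  have num: "(of_nat n :: 'a ratfun_closure) \<noteq> 0" if "n \<noteq> 0" for n
    using that by (simp flip: const_emb_of_nat)
  have two: "(2 :: 'a ratfun_closure) \<noteq> 0" using num[of 2] by simp
  have three: "(3 :: 'a ratfun_closure) \<noteq> 0" using num[of 3] by simp
  have "?h \<noteq> 0" "Polynomial.degree ?h \<le> 4"
    using assms by (simp_all add: map_poly_eq_0_iff degree_map_poly)
  moreover have "Polynomial.coeff ?h i \<in> ratfun_subfield" for i
    by (simp add: coeff_map_poly ratfun_subfield_def)
  ultimately obtain L where L: "radical_ext ratfun_subfield L" "\<And>x. poly ?h x = 0 \<Longrightarrow> x \<in> L"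
    using poly_degree_le_4_by_radicals[OF subfield_ratfun _ _ _ two three, of ?h] by blast
  note F = radical_ext_subfield[OF L(1) subfield_ratfun]
  from radical_ext_chain[OF L(1)] obtain Ks where Ks: "Ks \<noteq> []" "Ks ! 0 = ratfun_subfield" "last Ks = L"
     "\<forall>i. Suc i < length Ks \<longrightarrow>
        (\<exists>l a. l > 0 \<and> a \<in> Ks ! i \<and> a \<noteq> 0 \<and>
           Ks ! Suc i = splitting_field_over (Ks ! i) (Polynomial.monom 1 l - [:a:]))"
    by blast
  have "splitting_field_over ratfun_subfield ?h \<subseteq> L"
    unfolding splitting_field_over_def
    by (rule generate_field_least[OF F]) (use L radical_ext_mono[OF L(1)] in auto)
  with Ks have "root_tower g Ks" by (simp add: root_tower_def)
  thus thesis using that F Ks(3) L radical_ext_mono[OF L(1)] by metis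
qed

section \<open>Parametrizing lines and families of point sets on parallel lines\<close>

lemma eq_vector_2_iff: "P = vector [x, y] \<longleftrightarrow> P $ 1 = x \<and> P $ 2 = y"
  for P :: "'b::zero ^ 2"
  by (auto simp: vec_eq_iff forall_2)

lemma vector_2_param_residue:
  fixes V :: "'a::{alg_closed_field, field_char_0} \<Rightarrow> 'a ratfun_closure set"
  assumes "place_over t0 (V t0)"
    and "r - const_emb x \<in> valuation_ideal (V t0)" "s - const_emb y \<in> valuation_ideal (V t0)"
  shows "tuple_defined_at (V t0) (vector [r, s] :: 'a ratfun_closure ^ 2)"
    "tuple_value_at (V t0) (vector [r, s] :: 'a ratfun_closure ^ 2) = vector [x, y]"
proof -
  interpret ratfun_place t0 "V t0" by unfold_locales fact
  have *: "r \<in> V t0" if "r - const_emb x \<in> valuation_ideal (V t0)" for r x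
    using V_closed(4)[OF ideal_subset[OF that] const_in_V[of x]] by simp
  show "tuple_defined_at (V t0) (vector [r, s] :: 'a ratfun_closure ^ 2)"
    using *[OF assms(2)] *[OF assms(3)] by (simp add: tuple_defined_at_def forall_2)
  show "tuple_value_at (V t0) (vector [r, s] :: 'a ratfun_closure ^ 2) = vector [x, y]"
    using residue_eqI[OF assms(2)] residue_eqI[OF assms(3)]
    by (simp add: tuple_value_at_def eq_vector_2_iff)
qed

lemma poly_emb_in_ratfun: "poly_emb p \<in> ratfun_subfield"
  by (simp add: poly_emb_def ratfun_subfield_def)

text \<open>
  The obvious parametrization by \<open>t\<close> is regular everywhere and misses no point. It lies in the bottom
  field of any tower, so a tower of the constant polynomial \<open>1\<close> serves.
\<close>

lemma soluble_by_radicals_line: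
  fixes V :: "'a::{alg_closed_field, field_char_0} \<Rightarrow> 'a ratfun_closure set"
  assumes place: "\<And>t0. place_over t0 (V t0)" and dir: "a \<noteq> 0 \<or> b \<noteq> 0"
  shows "soluble_by_radicals V ({vector [x0 + a * s, y0 + b * s] | s. True} :: ('a ^ 2) set)"
    (is "soluble_by_radicals V ?C")
proof -
  define R :: "'a ratfun_closure ^ 2" where "R = vector [poly_emb [:x0, a:], poly_emb [:y0, b:]]"
  obtain Ks where Ks: "root_tower (1 :: 'a ratfun poly) Ks" "ratfun_subfield \<subseteq> last Ks"
    using root_tower_degree_le_4[of "1 :: 'a ratfun poly"] by auto
  have nonconst: "poly_emb [:x, c:] \<notin> range const_emb" if "c \<noteq> 0" for x c :: 'a
  proof
    assume "poly_emb [:x, c:] \<in> range const_emb"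
    then obtain d where "poly_emb [:x, c:] = poly_emb [:d:]" by (auto simp: const_emb_eq)
    hence "poly_emb ([:x, c:] - [:d:]) = 0" by (simp only: poly_emb_hom diff_self)
    thus False using that by (simp only: poly_emb_eq_0_iff) simp
  qed
  have "\<forall>j. R $ j \<in> last Ks"
    using poly_emb_in_ratfun Ks(2) unfolding R_def forall_2 by auto
  moreover have "\<not> (\<forall>j. R $ j \<in> range const_emb)"
    using dir nonconst unfolding R_def forall_2 by auto
  ultimately have sq: "square_parametrization R"
    using Ks(1) unfolding square_parametrization_def soluble_poly_def by blast
  have val: "tuple_defined_at (V t0) R \<and> tuple_value_at (V t0) R = vector [x0 + a * t0, y0 + b * t0]" for t0
  proof -
    interpret ratfun_place t0 "V t0" by unfold_locales fact
    show ?thesis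
      using vector_2_param_residue[of t0 V, OF place poly_emb_residue[of "[:x0, a:]"] poly_emb_residue[of "[:y0, b:]"]]
      by (simp add: R_def mult.commute)
  qed
  have "{P \<in> ?C. \<not> (\<exists>t0. \<exists>R\<in>{R}. tuple_defined_at (V t0) R \<and> P = tuple_value_at (V t0) R)} = {}"
    using val by auto
  hence "finite {P \<in> ?C. \<not> (\<exists>t0. \<exists>R\<in>{R}. tuple_defined_at (V t0) R \<and> P = tuple_value_at (V t0) R)}"
    by (simp only: finite.emptyI)
  moreover have "\<forall>R\<in>{R}. \<forall>t0. tuple_defined_at (V t0) R \<longrightarrow> tuple_value_at (V t0) R \<in> ?C"
    using val by auto
  ultimately show ?thesis
    unfolding soluble_by_radicals_def using sq by (intro exI[of _ "{R}"]) auto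
qed

lemma poly_fibre: "poly (map_poly (\<lambda>p. poly p u) H) v = poly (poly H [:v:]) u"
  for u :: "'a::comm_ring_1"
  by (induction H) (simp_all add: map_poly_pCons)

text \<open>
  A curve is described here in the coordinates \<open>(u, v)\<close> of a pencil of parallel lines; \<open>H\<close>
  restricted to the line of parameter \<open>u\<close> cuts out the points of the curve on it. The assumption
  \<open>fibre\<close> says that no line of the pencil is contained in the curve; it enters both through
  \<open>root_specializes\<close> and to make the set of missed points finite on each exceptional line.
\<close>

lemma soluble_by_radicals_family:
  fixes V :: "'a::{alg_closed_field, field_char_0} \<Rightarrow> 'a ratfun_closure set"
    and C :: "('a ^ 2) set"
  assumes place: "\<And>t0. place_over t0 (V t0)"
    and deg: "Polynomial.degree H \<le> 4" and fibre: "\<And>u. map_poly (\<lambda>p. poly p u) H \<noteq> 0"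
    and det: "a * b' \<noteq> b * a'"
    and C: "\<And>u v. vector [a * v + a' * u, b * v + b' * u] \<in> C \<longleftrightarrow>
              poly (map_poly (\<lambda>p. poly p u) H) v = 0"
  shows "soluble_by_radicals V C"
proof -
  define pt :: "'a \<Rightarrow> 'a \<Rightarrow> 'a ^ 2" where
    "pt u v = vector [a * v + a' * u, b * v + b' * u]" for u v
  define h where "h = map_poly poly_emb H"
  define R :: "'a ratfun_closure \<Rightarrow> 'a ratfun_closure ^ 2" where
    "R r = vector [const_emb a * r + const_emb a' * param_var,
                   const_emb b * r + const_emb b' * param_var]" for r
  define D where "D = a * b' - b * a'"
  have D: "D \<noteq> 0" using det by (simp add: D_def)
  have "H \<noteq> 0" using fibre[of 0] by auto
  hence "h \<noteq> 0" by (simp add: h_def map_poly_eq_0_iff)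

  define g where "g = map_poly (\<lambda>p. Fract p 1) H"
  have gh: "map_poly to_ac g = h"
    unfolding g_def h_def poly_emb_def by (subst map_poly_map_poly) (simp_all add: o_def fract_collapse)
  have "g \<noteq> 0" using \<open>h \<noteq> 0\<close> gh by auto
  moreover have "Polynomial.degree g \<le> 4"
    using deg map_poly_degree_leq[of "\<lambda>p. Fract p 1" H] unfolding g_def by linarith
  ultimately obtain Ks where Ks: "root_tower g Ks" "subfield (last Ks) ring_of_type_algebra"
    "ratfun_subfield \<subseteq> last Ks" "\<And>x. poly h x = 0 \<Longrightarrow> x \<in> last Ks"
    using root_tower_degree_le_4 gh by metis
  note K = subfield_closed[OF Ks(2)]

  have sq: "square_parametrization (R r)" if r: "poly h r = 0" for r
  proof -
    have "const_emb c \<in> last Ks" for c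
      using poly_emb_in_ratfun Ks(3) by (auto simp: const_emb_eq)
    moreover have "param_var \<in> last Ks"
      using poly_emb_in_ratfun Ks(3) by (auto simp: param_var_eq)
    ultimately have "\<forall>j. R r $ j \<in> last Ks"
      using Ks(4)[OF r] by (simp add: R_def forall_2 K)
    moreover have "\<not> (\<forall>j. R r $ j \<in> range const_emb)"
    proof
      assume "\<forall>j. R r $ j \<in> range const_emb"
      then obtain c d where cd: "R r $ 1 = const_emb c" "R r $ 2 = const_emb d"
        by (auto simp: forall_2)
      have "const_emb D * param_var = const_emb a * R r $ 2 - const_emb b * R r $ 1"
        by (simp add: R_def D_def algebra_simps)
      also have "\<dots> = const_emb (a * d - b * c)" unfolding cd by simp
      finally show False using param_var_transcendental D by blast
    qed
    ultimately show ?thesis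
      using Ks(1) unfolding square_parametrization_def soluble_poly_def by blast
  qed

  \<comment> \<open>Both coordinates are linear in \<open>r\<close> and \<open>t\<close>, so they reduce to the coordinates of \<open>pt u v\<close>.\<close>
  have place_value: "tuple_defined_at (V u) (R r)" "tuple_value_at (V u) (R r) = pt u v"
    if "r - const_emb v \<in> valuation_ideal (V u)" for u v r
  proof -
    interpret ratfun_place u "V u" by unfold_locales fact
    have "const_emb p * r + const_emb q * param_var - const_emb (p * v + q * u) \<in> \<mm>" for p q
    proof -
      have "const_emb p * (r - const_emb v) + const_emb q * (param_var - const_emb u) \<in> \<mm>"
        by (intro ideal_add ideal_mult that param_minus_const const_in_V)
      thus ?thesis by (simp add: algebra_simps)
    qed
    from vector_2_param_residue[of u V, OF place this this]
    show "tuple_defined_at (V u) (R r)" "tuple_value_at (V u) (R r) = pt u v"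
      by (simp_all add: R_def pt_def)
  qed

  have on_curve: "tuple_value_at (V u) (R r) \<in> C"
    if r: "poly h r = 0" and def: "tuple_defined_at (V u) (R r)" for u r
  proof -
    interpret ratfun_place u "V u" by unfold_locales fact
    \<comment> \<open>Solving the linear coordinate change for \<open>r\<close> shows that \<open>r\<close> is regular where \<open>R r\<close> is.\<close>
    have "const_emb (inverse D) * (const_emb b' * R r $ 1 - const_emb a' * R r $ 2) \<in> V u"
      using def by (intro V_closed const_in_V) (simp_all add: tuple_defined_at_def)
    also have "const_emb b' * R r $ 1 - const_emb a' * R r $ 2 = const_emb D * r"
      by (simp add: R_def D_def algebra_simps)
    also have "const_emb (inverse D) * (const_emb D * r) = const_emb (inverse D * D) * r"
      by (simp only: const_emb_hom mult.assoc)
    finally have "r \<in> V u" using D by simp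
    with r[unfolded h_def] obtain v where v: "r - const_emb v \<in> \<mm>"
      "poly (map_poly (\<lambda>p. poly p u) H) v = 0"
      using root_specializes fibre by metis
    thus ?thesis using place_value(2)[OF v(1)] C by (simp add: pt_def)
  qed

  have coord: "\<exists>u v. P = pt u v" for P
  proof (intro exI)
    define i where "i = inverse D"
    have Di: "D * i = 1" using D by (simp add: i_def)
    let ?u = "(a * P $ 2 - b * P $ 1) * i" and ?v = "(b' * P $ 1 - a' * P $ 2) * i"
    have "a * ?v + a' * ?u = D * i * P $ 1" "b * ?v + b' * ?u = D * i * P $ 2"
      by (simp_all add: D_def algebra_simps)
    thus "P = pt ?u ?v"
      unfolding pt_def eq_vector_2_iff using Di by simp
  qed

  let ?Ps = "R ` {r. poly h r = 0}"
  let ?missed = "{P \<in> C. \<not> (\<exists>t0. \<exists>R\<in>?Ps. tuple_defined_at (V t0) R \<and> P = tuple_value_at (V t0) R)}"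
  let ?bad = "SIGMA u:{u. poly (Polynomial.lead_coeff H) u = 0}. {v. poly (map_poly (\<lambda>p. poly p u) H) v = 0}"
  have sub: "?missed \<subseteq> (\<lambda>(u, v). pt u v) ` ?bad"
  proof
    fix P assume P: "P \<in> ?missed"
    obtain u v where uv: "P = pt u v" using coord by blast
    have v: "poly (map_poly (\<lambda>p. poly p u) H) v = 0"
      using P C unfolding uv pt_def by blast
    interpret ratfun_place u "V u" by unfold_locales fact
    have "poly (Polynomial.lead_coeff H) u = 0"
    proof (rule ccontr)
      assume "poly (Polynomial.lead_coeff H) u \<noteq> 0"
      with v obtain r where r: "poly h r = 0" "r - const_emb v \<in> \<mm>"
        using root_lifts unfolding h_def by metis
      from r(1) have "R r \<in> ?Ps" by blast
      moreover have "P = tuple_value_at (V u) (R r)" using place_value(2)[OF r(2)] uv by simp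
      ultimately show False using P place_value(1)[OF r(2)] by blast
    qed
    with uv v show "P \<in> (\<lambda>(u, v). pt u v) ` ?bad" by auto
  qed
  have fin: "finite ?bad"
    using \<open>H \<noteq> 0\<close> fibre by (intro finite_SigmaI poly_roots_finite) auto
  from finite_surj[OF fin sub] have "finite ?missed" .
  moreover have "finite ?Ps" using \<open>h \<noteq> 0\<close> by (intro finite_imageI poly_roots_finite)
  moreover have "\<forall>S\<in>?Ps. square_parametrization S" using sq by blast
  moreover have "\<forall>S\<in>?Ps. \<forall>t0. tuple_defined_at (V t0) S \<longrightarrow> tuple_value_at (V t0) S \<in> C"
    using on_curve by blast
  ultimately show ?thesis
    unfolding soluble_by_radicals_def by blast
qed

section \<open>Lines contained in irreducible curves\<close>

text \<open>
  The zero of \<open>l\<close> certifies that \<open>l\<close> is not a unit; the cofactor then is one, and so vanishes nowhere.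
\<close>

lemma plane_zeros_irreducible_eq_divisor:
  fixes f :: "'a::field poly poly"
  assumes irr: "Factorial_Ring.irreducible f" and "l dvd f" and zero: "plane_zeros l \<noteq> {}"
  shows "plane_zeros f = plane_zeros l"
proof -
  obtain w where f: "f = l * w" using \<open>l dvd f\<close> by blast
  have unit: "poly (poly k [:y:]) x \<noteq> 0" if "k dvd 1" for k :: "'a poly poly" and x y
  proof
    assume 0: "poly (poly k [:y:]) x = 0"
    from that obtain k' where "1 = k * k'" by blast
    hence "poly (poly 1 [:y:]) x = poly (poly (k * k') [:y:]) x" by (rule arg_cong)
    thus False using 0 by simp
  qed
  have "\<not> l dvd 1" using unit zero by (auto simp: plane_zeros_def)
  hence "w dvd 1" using irreducibleD[OF irr f] by blast
  thus ?thesis using unit by (auto simp: f plane_zeros_def)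
qed

text \<open>
  An equation of the line divides \<open>f\<close>. Since \<open>f\<close> is a polynomial in \<open>y\<close> over polynomials in \<open>x\<close>,
  this takes two forms: a line that is a graph over the \<open>x\<close>-axis gives a root of \<open>f\<close> in the
  coefficient ring, and a vertical line gives a common root of the coefficients.
\<close>

lemma irreducible_plane_zeros_line:
  fixes f :: "'a::field_char_0 poly poly"
  assumes irr: "Factorial_Ring.irreducible f" and dir: "a \<noteq> 0 \<or> b \<noteq> 0"
    and van: "\<And>s. poly (poly f [:y0 + b * s:]) (x0 + a * s) = 0"
  shows "plane_zeros f = {vector [x0 + a * s, y0 + b * s] | s. True}" (is "_ = ?L")
proof (cases "a = 0")
  case False
  define p where "p = [:y0 - b / a * x0, b / a:]"
  have "poly (poly f p) x = 0" for x
  proof -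
    have "poly (poly g p) x = poly (poly g [:poly p x:]) x" for g by (induction g) auto
    also have "poly p x = y0 + b * ((x - x0) / a)" by (simp add: p_def diff_divide_distrib algebra_simps)
    also have "poly (poly f [:\<dots>:]) x = 0" using van[of "(x - x0) / a"] False by simp
    finally show ?thesis .
  qed
  hence "poly f p = 0" by (simp flip: poly_all_0_iff_0)
  hence "[:- p, 1:] dvd f" by (simp add: poly_eq_0_iff_dvd)
  moreover have "plane_zeros [:- p, 1:] = ?L"
  proof (intro Set.set_eqI iffI)
    fix P assume "P \<in> plane_zeros [:- p, 1:]"
    hence "P $ 2 = poly p (P $ 1)" by (simp add: plane_zeros_def algebra_simps)
    hence "P = vector [x0 + a * ((P $ 1 - x0) / a), y0 + b * ((P $ 1 - x0) / a)]"
      using False unfolding eq_vector_2_iff by (simp add: p_def diff_divide_distrib algebra_simps)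
    thus "P \<in> ?L" by blast
  next
    fix P assume "P \<in> ?L"
    then obtain s where "P = vector [x0 + a * s, y0 + b * s]" by blast
    thus "P \<in> plane_zeros [:- p, 1:]"
      using False by (simp add: plane_zeros_def p_def field_simps)
  qed
  moreover have "vector [x0 + a * 0, y0 + b * 0] \<in> ?L" by blast
  ultimately show ?thesis using plane_zeros_irreducible_eq_divisor[OF irr] by blast
next
  case True
  hence b: "b \<noteq> 0" using dir by simp
  have "poly (map_poly (\<lambda>p. poly p x0) f) y = 0" for y
    using van[of "(y - y0) / b"] True b by (simp add: poly_fibre)
  hence "map_poly (\<lambda>p. poly p x0) f = 0" by (simp flip: poly_all_0_iff_0)
  hence "poly (Polynomial.coeff f n) x0 = 0" for n by (metis coeff_map_poly coeff_0 poly_0)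
  hence "[:[:- x0, 1:]:] dvd f" by (simp add: const_poly_dvd_iff poly_eq_0_iff_dvd)
  moreover have "plane_zeros [:[:- x0, 1:]:] = ?L"
  proof (intro Set.set_eqI iffI)
    fix P assume "P \<in> plane_zeros [:[:- x0, 1:]:]"
    hence "P = vector [x0 + a * ((P $ 2 - y0) / b), y0 + b * ((P $ 2 - y0) / b)]"
      using b True unfolding eq_vector_2_iff by (simp add: plane_zeros_def)
    thus "P \<in> ?L" by blast
  qed (auto simp: plane_zeros_def True)
  moreover have "vector [x0 + a * 0, y0 + b * 0] \<in> ?L" by blast
  ultimately show ?thesis using plane_zeros_irreducible_eq_divisor[OF irr] by blast
qed

section \<open>Projection from a point at infinity\<close>

lemma coeff_mult_at_degree_bounds:
  assumes "Polynomial.degree p \<le> m" "Polynomial.degree q \<le> n"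
  shows "Polynomial.coeff (p * q) (m + n) = Polynomial.coeff p m * Polynomial.coeff q n"
proof -
  have "Polynomial.coeff p i * Polynomial.coeff q (m + n - i) =
      (if i = m then Polynomial.coeff p m * Polynomial.coeff q n else 0)" for i
    using assms coeff_eq_0[of p i] coeff_eq_0[of q "m + n - i"] by (cases i m rule: linorder_cases) auto
  thus ?thesis by (simp add: coeff_mult)
qed

lemma coeff_power_linear:
  assumes "Polynomial.degree p \<le> 1"
  shows "Polynomial.degree (p ^ i) \<le> i" "Polynomial.coeff (p ^ i) i = Polynomial.coeff p 1 ^ i"
proof (induction i)
  case (Suc i)
  { case 1 show ?case using degree_mult_le[of p "p ^ i"] Suc(1) assms by simp }
  { case 2 show ?case using coeff_mult_at_degree_bounds[OF assms Suc(1)] Suc(2) by simp }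
qed simp_all

lemma coeff_eq_0_total_deg:
  assumes "total_deg f < i + j"
  shows "Polynomial.coeff (Polynomial.coeff f j) i = 0"
proof (rule ccontr)
  let ?S = "{i + j | i j. Polynomial.coeff (Polynomial.coeff f j) i \<noteq> 0}"
  assume "Polynomial.coeff (Polynomial.coeff f j) i \<noteq> 0"
  hence "i + j \<in> insert 0 ?S" by blast
  moreover have "finite (insert 0 ?S)"
  proof -
    have "?S \<subseteq> (\<lambda>(j, i). i + j) ` (SIGMA j:{..Polynomial.degree f}. {..Polynomial.degree (Polynomial.coeff f j)})"
      by (force intro: le_degree)
    from finite_subset[OF this] show ?thesis by simp
  qed
  ultimately have "i + j \<le> total_deg f" unfolding total_deg_def by (rule Max_ge[rotated])
  with assms show False by simp
qed

lemma poly_eq_sum_le: "Polynomial.degree p \<le> n \<Longrightarrow> poly p x = (\<Sum>i\<le>n. Polynomial.coeff p i * x ^ i)"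
  for x :: "'a::comm_semiring_1"
  unfolding poly_altdef by (intro sum.mono_neutral_left) (auto simp: coeff_eq_0)

text \<open>
  Either \<open>(1, 0)\<close> is a zero of the binary form, or the form stays of degree \<open>N\<close> after setting
  \<open>b = 1\<close>.
\<close>

lemma form_has_zero:
  fixes c :: "nat \<Rightarrow> 'a::alg_closed_field"
  assumes "N > 0"
  obtains a b where "a \<noteq> 0 \<or> b \<noteq> 0" "(\<Sum>i\<le>N. c i * (a ^ i * b ^ (N - i))) = 0"
proof (cases "c N = 0")
  case True
  have "(\<Sum>i\<le>N. c i * (1 ^ i * 0 ^ (N - i))) = 0"
    using True by (intro sum.neutral) (auto simp: le_less)
  thus ?thesis using that[of 1 0] by simp
next
  case False
  define q where "q = (\<Sum>i\<le>N. Polynomial.monom (c i) i)"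
  have "Polynomial.coeff q N = c N" by (simp add: q_def coeff_sum)
  hence "Polynomial.degree q > 0" using False assms le_degree[of q N] by simp
  then obtain a where "poly q a = 0" using alg_closed_imp_poly_has_root by blast
  thus ?thesis using that[of a 1] by (simp add: q_def poly_sum poly_monom)
qed

text \<open>
  Substituting \<open>x = a v + a' u\<close> and \<open>y = b v + b' u\<close> into \<open>f\<close>, the coefficient of \<open>v ^ Suc n\<close>
  is the form of degree \<open>Suc n\<close> of \<open>f\<close> evaluated at \<open>(a, b)\<close>. The direction is chosen as a zero
  of this form, so that the degree in \<open>v\<close> drops. If \<open>total_deg f \<le> n\<close>, the form is zero and
  every direction will do.
\<close>

lemma pencil_of_parallel_lines:
  fixes f :: "'a::alg_closed_field poly poly"
  assumes "total_deg f \<le> Suc n"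
  obtains a b a' b' H where "a * b' \<noteq> b * a'" "Polynomial.degree H \<le> n"
    "\<And>u v. poly (map_poly (\<lambda>p. poly p u) H) v = poly (poly f [:b * v + b' * u:]) (a * v + a' * u)"
proof -
  define N where "N = Suc n"
  define c where "c = (\<lambda>i j. Polynomial.coeff (Polynomial.coeff f j) i)"
  have c0: "c i j = 0" if "i + j > N" for i j
    unfolding c_def by (rule coeff_eq_0_total_deg) (use assms that in \<open>simp add: N_def\<close>)
  obtain a b where ab: "a \<noteq> 0 \<or> b \<noteq> 0" "(\<Sum>i\<le>N. c i (N - i) * (a ^ i * b ^ (N - i))) = 0"
    using form_has_zero[of N "\<lambda>i. c i (N - i)"] by (auto simp: N_def)
  obtain a' b' where det: "a * b' \<noteq> b * a'"
    using ab(1) by (metis mult_zero_right mult_1_right)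
  define Lx where "Lx = [:[:0, a':], [:a:]:]"
  define Ly where "Ly = [:[:0, b':], [:b:]:]"
  define H where "H = (\<Sum>j\<le>N. \<Sum>i\<le>N. Polynomial.smult [:c i j:] (Lx ^ i * Ly ^ j))"
  have Lx: "Polynomial.degree Lx \<le> 1" "Polynomial.coeff Lx 1 = [:a:]"
    and Ly: "Polynomial.degree Ly \<le> 1" "Polynomial.coeff Ly 1 = [:b:]"
    by (simp_all add: Lx_def Ly_def)
  have deg_mono: "Polynomial.degree (Lx ^ i * Ly ^ j) \<le> i + j" for i j
    using degree_mult_le[of "Lx ^ i" "Ly ^ j"] coeff_power_linear(1)[OF Lx(1), of i]
      coeff_power_linear(1)[OF Ly(1), of j] by linarith
  have top_mono: "Polynomial.coeff (Lx ^ i * Ly ^ j) (i + j) = [:a ^ i * b ^ j:]" for i j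
    unfolding coeff_mult_at_degree_bounds[OF coeff_power_linear(1)[OF Lx(1)] coeff_power_linear(1)[OF Ly(1)]]
      coeff_power_linear(2)[OF Lx(1)] coeff_power_linear(2)[OF Ly(1)] Lx(2) Ly(2) poly_const_pow
    by simp
  have coH: "Polynomial.coeff H k = (\<Sum>j\<le>N. \<Sum>i\<le>N. [:c i j:] * Polynomial.coeff (Lx ^ i * Ly ^ j) k)" for k
    by (simp add: H_def coeff_sum)
  have "Polynomial.coeff H k = 0" if "k > n" for k
  proof (cases "k = N")
    case False
    hence "[:c i j:] * Polynomial.coeff (Lx ^ i * Ly ^ j) k = 0" for i j
      using c0[of i j] coeff_eq_0[of "Lx ^ i * Ly ^ j" k] deg_mono[of i j] that
      by (cases "i + j > N") (auto simp: N_def)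
    thus ?thesis unfolding coH by (simp only: sum.neutral_const)
  next
    case True
    have "[:c i j:] * Polynomial.coeff (Lx ^ i * Ly ^ j) N =
        (if j = N - i then [:c i (N - i) * (a ^ i * b ^ (N - i)):] else 0)" if "i \<le> N" for i j
    proof (cases "i + j" N rule: linorder_cases)
      case less
      thus ?thesis using coeff_eq_0[of "Lx ^ i * Ly ^ j" N] deg_mono[of i j] by simp
    next
      case equal
      hence "j = N - i" by simp
      moreover have "Polynomial.coeff (Lx ^ i * Ly ^ j) N = [:a ^ i * b ^ j:]"
        using top_mono[of i j] unfolding equal .
      ultimately show ?thesis by simp
    next
      case greater
      thus ?thesis using c0[of i j] that by auto
    qed
    hence "Polynomial.coeff H N = (\<Sum>j\<le>N. \<Sum>i\<le>N. if j = N - i then [:c i (N - i) * (a ^ i * b ^ (N - i)):] else 0)"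
      unfolding coH by (intro sum.cong refl) auto
    also have "\<dots> = (\<Sum>i\<le>N. [:c i (N - i) * (a ^ i * b ^ (N - i)):])"
      by (subst sum.swap) (simp add: sum.delta)
    also have "\<dots> = [:\<Sum>i\<le>N. c i (N - i) * (a ^ i * b ^ (N - i)):]"
      by (rule poly_eqI) (simp add: coeff_sum coeff_pCons split: nat.split)
    finally show ?thesis using True ab(2) by simp
  qed
  hence degH: "Polynomial.degree H \<le> n" by (rule degree_le[rule_format])
  show thesis
  proof (rule that[OF det degH])
    fix u v
    let ?x = "a * v + a' * u" and ?y = "b * v + b' * u"
    have "poly (map_poly (\<lambda>p. poly p u) H) v = (\<Sum>j\<le>N. \<Sum>i\<le>N. c i j * (?x ^ i * ?y ^ j))"
      by (simp add: poly_fibre H_def Lx_def Ly_def poly_sum algebra_simps)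
    also have "\<dots> = (\<Sum>j\<le>N. poly (Polynomial.coeff f j) ?x * ?y ^ j)"
    proof (rule sum.cong[OF HOL.refl])
      fix j
      have "Polynomial.degree (Polynomial.coeff f j) \<le> N"
        by (rule degree_le) (use c0 in \<open>simp add: c_def\<close>)
      from poly_eq_sum_le[OF this, of ?x]
      show "(\<Sum>i\<le>N. c i j * (?x ^ i * ?y ^ j)) = poly (Polynomial.coeff f j) ?x * ?y ^ j"
        by (simp add: c_def sum_distrib_right mult.assoc)
    qed
    also have "\<dots> = poly (poly f [:?y:]) ?x"
    proof -
      have "Polynomial.coeff f j = 0" if "N < j" for j
        by (rule poly_eqI) (use c0 that in \<open>simp add: c_def\<close>)
      hence "Polynomial.degree f \<le> N" by (rule degree_le[rule_format])
      from poly_eq_sum_le[OF this, of "[:?y:]"] show ?thesis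
        by (simp add: poly_sum poly_const_pow mult.commute)
    qed
    finally show "poly (map_poly (\<lambda>p. poly p u) H) v = poly (poly f [:?y:]) ?x" .
  qed
qed

theorem corollary3p2:
  fixes C :: "('a :: {alg_closed_field, field_char_0} ^ 2) set"
    and V :: "'a \<Rightarrow> 'a ratfun_closure set"
    and d :: nat
  assumes "\<And>t0. place_over t0 (V t0)"
    and "irreducible_plane_curve d C"
    and "d \<le> 5"
  shows "soluble_by_radicals V C"
proof -
  obtain f where irr: "Factorial_Ring.irreducible f" and deg: "total_deg f = d"
    and C: "C = plane_zeros f"
    using assms(2) by (auto simp: irreducible_plane_curve_def)
  from deg assms(3) have "total_deg f \<le> Suc 4" by simp
  then obtain a b a' b' H where det: "a * b' \<noteq> b * a'" and degH: "Polynomial.degree H \<le> 4"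
    and H: "\<And>u v. poly (map_poly (\<lambda>p. poly p u) H) v
      = poly (poly f [:b * v + b' * u:]) (a * v + a' * u)"
    using pencil_of_parallel_lines by metis
  show ?thesis
  proof (cases "\<exists>u. map_poly (\<lambda>p. poly p u) H = 0")
    case True
    then obtain u where "map_poly (\<lambda>p. poly p u) H = 0" ..
    hence "poly (poly f [:b' * u + b * s:]) (a' * u + a * s) = 0" for s
      using H[of u s] by (simp add: add.commute)
    moreover have dir: "a \<noteq> 0 \<or> b \<noteq> 0" using det by auto
    ultimately have "C = {vector [a' * u + a * s, b' * u + b * s] | s. True}"
      unfolding C using irreducible_plane_zeros_line[OF irr] by blast
    thus ?thesis using soluble_by_radicals_line[OF assms(1) dir] by simp
  next
    case False
    show ?thesis
      by (rule soluble_by_radicals_family[OF assms(1) degH _ det])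
         (use False in \<open>auto simp: C plane_zeros_def H\<close>)
  qed
qed

end
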